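(* For every integer $p\ge 1$, $$\sum_{j=1}^{p}{p+1\brace p-j}\frac{H_{j}}{j!}=\frac{p!-(p+1)p^{p}+p^{p+1}H_{p}}{p!}.$$
   Context: ${n\brace k}$ denotes the Stirling number of the second kind, i.e. $\sum_{n\ge 0}{n\brace k}\frac{t^n}{n!}=\frac{(e^t-1)^k}{k!}$ (in particular ${n\brace 0}=0$ for $n\ge 1$). $H_n=\sum_{j=1}^{n}\frac1j$ is the $n$th harmonic number. *)

theory Defs
  imports "HOL-Analysis.Harmonic_Numbers" "HOL-Combinatorics.Stirling"
begin

end

theory Submission imports Defs begin

text \<open>
  Expand \<open>x\<close> to the power \<open>p + 1\<close> in falling factorials, with Stirling numbers of the second kind as
  coefficients. Evaluating this polynomial identity at \<open>x = p\<close> gives a sum of \<open>{p + 1, k} / (p - k)!\<close>;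
  differentiating it at \<open>x = p\<close> weights the terms by \<open>H\<^sub>p - H\<^bsub>p - k\<^esub>\<close>, apart from the top term
  \<open>k = p + 1\<close>, which contributes \<open>p!\<close>. Eliminating the unweighted sum and reindexing by
  \<open>j = p - k\<close> yields the claim.
\<close>

lemma power_eq_sum_Stirling_falling:
  fixes x :: "'a::comm_ring_1"
  shows "x ^ n = (\<Sum>k\<le>n. of_nat (Stirling n k) * (\<Prod>i<k. x - of_nat i))"
proof (induction n)
  case 0
  show ?case by simp
next
  case (Suc n)
  define F where "F k = (\<Prod>i<k. x - of_nat i)" for k
  \<comment> \<open>Splitting \<open>x\<close> as \<open>(x - k) + k\<close> makes multiplication by
    \<open>x\<close> act on the falling factorials in the same way as the Stirling
    recurrence.\<close>
  have F_Suc: "x * F k = F (Suc k) + of_nat k * F k" for k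
    by (simp add: F_def algebra_simps)
  have "x ^ Suc n = (\<Sum>k\<le>n. of_nat (Stirling n k) * (x * F k))"
    by (simp add: Suc F_def sum_distrib_left mult_ac)
  \<comment> \<open>The second sum may run up to \<open>Suc n\<close> because
    \<open>Stirling n (Suc n) = 0\<close>; its term at 0 vanishes too, so shifting the index aligns
    it with the first sum.\<close>
  also have "\<dots> = (\<Sum>k\<le>n. of_nat (Stirling n k) * F (Suc k))
      + (\<Sum>k\<le>Suc n. of_nat (k * Stirling n k) * F k)"
    by (simp add: F_Suc sum.distrib algebra_simps)
  also have "\<dots> = (\<Sum>k\<le>Suc n. of_nat (Stirling (Suc n) k) * F k)"
    by (simp add: sum.atMost_Suc_shift sum.distrib algebra_simps del: sum.atMost_Suc)
  finally show ?case by (simp only: F_def)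
qed

lemma falling_nat_eq_fact_div_fact:
  assumes "k \<le> p"
  shows "(\<Prod>i<k. real p - real i) = fact p / fact (p - k)"
  using assms
proof (induction k)
  case (Suc k)
  then obtain j where "p - k = Suc j" by (cases "p - k") auto
  then have j: "p - k = Suc j" "p - Suc k = j" "real p - real k = real (Suc j)"
    using Suc.prems by auto
  have "(\<Prod>i<Suc k. real p - real i) = fact p / fact (p - k) * (real p - real k)"
    using Suc by simp
  also have "\<dots> = fact p / fact (p - Suc k)"
    unfolding j by (simp del: of_nat_Suc)
  finally show ?case .
qed simp

lemma has_field_derivative_falling_Suc:
  assumes "((\<lambda>x. \<Prod>i<k. x - real i) has_field_derivative D) (at (real p))"
  shows "((\<lambda>x. \<Prod>i<Suc k. x - real i) has_field_derivative
    D * (real p - real k) + (\<Prod>i<k. real p - real i)) (at (real p))"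
  unfolding prod.lessThan_Suc
  by (rule derivative_eq_intros assms refl)+ simp

text \<open>For \<open>k \<le> p\<close> no factor vanishes at \<open>p\<close>, and the logarithmic
  derivative there is the sum of \<open>1 / (p - i)\<close> over \<open>i < k\<close>, which
  telescopes to a difference of harmonic numbers.\<close>

lemma has_field_derivative_falling:
  assumes "k \<le> p"
  shows "((\<lambda>x. \<Prod>i<k. x - real i) has_field_derivative
    fact p / fact (p - k) * (harm p - harm (p - k))) (at (real p))"
  using assms
proof (induction k)
  case (Suc k)
  then obtain j where "p - k = Suc j" by (cases "p - k") auto
  then have p: "p = Suc (k + j)" by simp
  have "((\<lambda>x. \<Prod>i<k. x - real i) has_field_derivative
      fact p / fact (p - k) * (harm p - harm (p - k))) (at (real p))"
    using Suc by simp
  from has_field_derivative_falling_Suc[OF this]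
  have D: "((\<lambda>x. \<Prod>i<Suc k. x - real i) has_field_derivative
      fact p / fact (p - k) * (harm p - harm (p - k)) * (real p - real k)
      + fact p / fact (p - k)) (at (real p))"
    using Suc.prems by (simp add: falling_nat_eq_fact_div_fact del: prod.lessThan_Suc)
  have j: "p - k = Suc j" "p - Suc k = j" "real p - real k = real (Suc j)"
    using p by auto
  \<comment> \<open>Used with \<open>s = p - k\<close>, \<open>f = (s - 1)!\<close> and
    \<open>g\<close> the harmonic number of \<open>s - 1\<close>: the extra term of the product rule
    cancels the \<open>inverse s\<close>.\<close>
  have alg: "a / (s * f) * (h - (g + inverse s)) * s + a / (s * f) = a / f * (h - g)"
    if "s \<noteq> 0" "f \<noteq> 0" for a s f h g :: real
    using that by (simp add: field_simps)
  have "fact p / fact (p - k) * (harm p - harm (p - k)) * (real p - real k)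
      + fact p / fact (p - k) = fact p / fact (p - Suc k) * (harm p - harm (p - Suc k) :: real)"
    unfolding j harm_Suc fact_Suc by (rule alg) auto
  with D show ?case by simp
qed simp

theorem corollary5:
  fixes p :: nat
  assumes "p \<ge> 1"
  shows "(\<Sum>j = 1..p. real (Stirling (p + 1) (p - j)) * (harm j / fact j)) =
    (fact p - (real p + 1) * real p ^ p + real p ^ (p + 1) * harm p) / fact p"
proof -
  define S where "S k = real (Stirling (p + 1) k)" for k
  define F where "F k x = (\<Prod>i<k. x - real i)" for k x
  \<comment> \<open>For \<open>k = p + 1\<close> the factor \<open>x - p\<close> vanishes at
    \<open>p\<close>, so only the product of the other factors, \<open>p!\<close>, survives.
    Truncated subtraction would make the first formula give \<open>p!\<close> times
    \<open>harm p\<close> instead.\<close>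
  define D where "D k = (if k \<le> p then fact p / fact (p - k) * (harm p - harm (p - k))
    else fact p :: real)" for k
  have expand: "x ^ Suc p = (\<Sum>k\<le>Suc p. S k * F k x)" for x
    unfolding S_def F_def using power_eq_sum_Stirling_falling[of x "Suc p"] by simp
  have "(F k has_field_derivative D k) (at (real p))" if "k \<le> Suc p" for k
  proof (cases "k = Suc p")
    case True
    from has_field_derivative_falling_Suc[OF has_field_derivative_falling[of p p]]
    show ?thesis
      by (simp add: True D_def F_def[abs_def] falling_nat_eq_fact_div_fact del: prod.lessThan_Suc)
  next
    case False
    with that show ?thesis
      using has_field_derivative_falling[of k p] by (simp add: D_def F_def[abs_def])
  qed
  then have "((\<lambda>x. \<Sum>k\<le>Suc p. S k * F k x) has_field_derivative (\<Sum>k\<le>Suc p. S k * D k))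
      (at (real p))"
    by (intro DERIV_sum DERIV_cmult) auto
  then have "((\<lambda>x. x ^ Suc p) has_field_derivative (\<Sum>k\<le>Suc p. S k * D k)) (at (real p))"
    by (simp only: expand)
  moreover have "((\<lambda>x. x ^ Suc p) has_field_derivative (real p + 1) * real p ^ p) (at (real p))"
    using DERIV_pow[of "Suc p" "real p"] by (simp add: add.commute)
  ultimately have "(\<Sum>k\<le>Suc p. S k * D k) = (real p + 1) * real p ^ p"
    by (rule DERIV_unique)
  moreover have "S (Suc p) = 1"
    by (simp add: S_def)
  ultimately have deriv:
    "(\<Sum>k\<le>p. S k * (fact p / fact (p - k) * (harm p - harm (p - k)))) + fact p
      = (real p + 1) * real p ^ p"
    by (simp add: D_def)
  have "F (Suc p) (real p) = 0"
    by (simp add: F_def)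
  then have val: "real p ^ Suc p = (\<Sum>k\<le>p. S k * (fact p / fact (p - k)))"
    unfolding expand by (simp add: F_def falling_nat_eq_fact_div_fact)
  define T where "T = (\<Sum>k\<le>p. S k * (harm (p - k) / fact (p - k)))"
  \<comment> \<open>The \<open>harm p\<close> part is a constant multiple of the unweighted sum,
    whose value is known from \<open>val\<close>.\<close>
  have "(\<Sum>k\<le>p. S k * (fact p / fact (p - k) * (harm p - harm (p - k))))
      = real p ^ Suc p * harm p - fact p * T"
    unfolding val T_def sum_distrib_left sum_distrib_right sum_subtractf[symmetric]
    by (intro sum.cong refl) (simp add: field_simps)
  with deriv have "fact p * T = fact p - (real p + 1) * real p ^ p + real p ^ (p + 1) * harm p"
    by simp
  then have "T = (fact p - (real p + 1) * real p ^ p + real p ^ (p + 1) * harm p) / fact p"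
    by (simp add: field_simps)
  moreover have "T = (\<Sum>j\<le>p. S (p - j) * (harm j / fact j))"
    unfolding T_def by (rule sum.reindex_bij_witness[of _ "\<lambda>j. p - j" "\<lambda>k. p - k"]) auto
  \<comment> \<open>The term \<open>j = 0\<close> drops out since \<open>harm 0 = 0\<close>.\<close>
  moreover have "(\<Sum>j\<le>p. S (p - j) * (harm j / fact j))
      = (\<Sum>j = 1..p. S (p - j) * (harm j / fact j))"
  proof (rule sum.mono_neutral_right)
    show "\<forall>j \<in> {..p} - {1..p}. S (p - j) * (harm j / fact j) = 0"
      by (auto simp: not_less_eq_eq harm_def)
  qed auto
  ultimately show ?thesis
    by (simp add: S_def)
qed

end
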